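(* Fix $\lambda,\mu,\beta>0$ with $\mu>\lambda+\beta$, and let $\alpha>0$ range over the values with $\lambda<\frac{\beta}{\alpha+\beta}\mu$. For each such $\alpha$ let $\pi$ be the stationary distribution of Model 1 (the unreliable $M/M/1$ server) with parameters $\lambda,\mu,\alpha,\beta$, let $\gamma_1$, $C^{(1)}(U)$ be the associated constants, and let $$\gamma=\frac{2\lambda}{\lambda+\beta+\mu+\alpha+\sqrt{s_1}},\qquad s_1=(\mu-\lambda-\beta-\alpha)^2+4\alpha\mu .$$ Then there is a constant $C(U)>0$ (not depending on $k$; it may depend on $\lambda,\mu,\alpha,\beta$) such that for each such $\alpha$, as $k\to\infty$, $$\pi(k,U)\sim C^{(1)}(U)\,\gamma_1^k+C(U)\,\gamma^k,$$ and moreover $$\lim_{k\to\infty}\ \lim_{\alpha\to0}\ \frac{\pi(k,U)}{C(U)\,\gamma^k}=1 .$$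
   Context: Notation: $n_k\sim m_k$ means $n_k/m_k\to1$ as $k\to\infty$; $\mathbb N=\{0,1,2,\dots\}$; $U$ = Up, $D$ = Down. Model 1: the continuous-time Markov chain on $\mathbb N\times\{U,D\}$ (number of customers, server status) with transition intensities: $(x,\sigma)\to(x+1,\sigma)$ at rate $\lambda$ for all $x\ge 0$, $\sigma\in\{U,D\}$; $(x,U)\to(x-1,U)$ at rate $\mu$ for $x\ge1$; $(x,U)\to(x,D)$ at rate $\alpha$ and $(x,D)\to(x,U)$ at rate $\beta$ for all $x\ge0$. Under $\lambda<\frac{\beta}{\alpha+\beta}\mu$ it has a unique stationary distribution $\pi$ (depending on $\alpha$). Constants (all depending on $\alpha$), with $s_1$ as in the claim: $$\gamma_1=\frac{2\lambda}{\lambda+\beta+\mu+\alpha-\sqrt{s_1}}\in(0,1),$$ $$G=\frac{\lambda+\beta-\mu-\alpha+\sqrt{s_1}}{2}+\frac{2\alpha\beta}{\lambda+\beta-\mu-\alpha+\sqrt{s_1}},\qquad C^{(1)}(U)=\frac{\eta^{(1)}}{\tilde d^{(1)}}\cdot\frac1G\cdot\frac{\lambda+\beta-\mu-\alpha+\sqrt{s_1}}{2}.$$ Here $C\ge\lambda+\mu+\alpha+\beta$ is a uniformization constant and $$\tilde d^{(1)}=\frac1C\left(\frac{\lambda+\beta+\mu+\alpha-\sqrt{s_1}}{2}-\frac1G\,\lambda\mu\,\frac{\lambda+\beta-\mu-\alpha+\sqrt{s_1}}{\lambda+\beta+\mu+\alpha-\sqrt{s_1}}\right).$$ Definition of $\eta^{(1)}$: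 let $\mathbf K^\infty$ be the kernel on $\mathbb Z\times\{U,D\}$ (the free process), shift invariant in the first coordinate, with $\mathbf K^\infty((m,\sigma),(m+1,\sigma))=\lambda/C$ for $\sigma\in\{U,D\}$, $\mathbf K^\infty((m,U),(m-1,U))=\mu/C$, $\mathbf K^\infty((m,U),(m,D))=\alpha/C$, $\mathbf K^\infty((m,D),(m,U))=\beta/C$, $\mathbf K^\infty((m,D),(m,D))=1-\frac{\lambda+\beta}{C}$, $\mathbf K^\infty((m,U),(m,U))=1-\frac{\lambda+\mu+\alpha}{C}$. Let $h(x,U)=\gamma_1^{-x}$ and $h(x,D)=\gamma_1^{-x}\,\frac{2\beta}{\lambda+\beta-\mu-\alpha+\sqrt{s_1}}$, and let the twisted free process be the discrete-time Markov chain with transition kernel $\mathcal K(z,z')=\mathbf K^\infty(z,z')h(z')/h(z)$. Then $$\eta^{(1)}=\sum_{\sigma\in\{U,D\}}\pi(0,\sigma)\,h(0,\sigma)\,\mathcal H(0,\sigma),$$ where $\mathcal H(0,\sigma)$ is the probability that the twisted free process started at $(0,\sigma)$ has strictly positive first coordinate at all times $n\ge1$. *)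

theory Defs
  imports "HOL-Probability.Probability"
begin

datatype status = Up | Down

section \<open>Continuous-time Markov chains given by transition intensities\<close>

text \<open>Only the values \<open>q z w\<close> with \<open>z \<noteq> w\<close> matter; the diagonal of the generator is determined
  by them. A distribution \<open>p\<close> is stationary when \<open>pQ = 0\<close>; this is adequate here because the total
  rates of the model are bounded, so that the chain does not explode.\<close>

definition generator :: "('s \<Rightarrow> 's \<Rightarrow> real) \<Rightarrow> 's \<Rightarrow> 's \<Rightarrow> real" where
  "generator q z w = (if z = w then - (\<Sum>\<^sub>\<infinity>v\<in>-{z}. q z v) else q z w)"

definition stationary :: "('s \<Rightarrow> 's \<Rightarrow> real) \<Rightarrow> 's pmf \<Rightarrow> bool" where
  "stationary q p \<longleftrightarrow> (\<forall>w. ((\<lambda>z. pmf p z * generator q z w) has_sum 0) UNIV)"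

fun unreliable_rate :: "real \<Rightarrow> real \<Rightarrow> real \<Rightarrow> real \<Rightarrow> nat \<times> status \<Rightarrow> nat \<times> status \<Rightarrow> real" where
  "unreliable_rate l \<mu> \<alpha> \<beta> (x, Up) (y, Up) =
     (if y = x + 1 then l else if x = y + 1 then \<mu> else 0)"
| "unreliable_rate l \<mu> \<alpha> \<beta> (x, Down) (y, Down) = (if y = x + 1 then l else 0)"
| "unreliable_rate l \<mu> \<alpha> \<beta> (x, Up) (y, Down) = (if y = x then \<alpha> else 0)"
| "unreliable_rate l \<mu> \<alpha> \<beta> (x, Down) (y, Up) = (if y = x then \<beta> else 0)"


section \<open>Path measure of a discrete-time Markov chain\<close>

text \<open>The law on \<open>nat \<Rightarrow> 's\<close> of the chain with transition kernel \<open>K\<close> started at \<open>s\<close>, as the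
  Ionescu-Tulcea limit: \<open>chain_step K s n \<omega>\<close> is the conditional law of the state at time \<open>n\<close> given
  the states \<open>\<omega> 0, \<dots>, \<omega> (n - 1)\<close>.\<close>

definition chain_step :: "('s \<Rightarrow> 's pmf) \<Rightarrow> 's \<Rightarrow> nat \<Rightarrow> (nat \<Rightarrow> 's) \<Rightarrow> 's measure" where
  "chain_step K s n \<omega> = measure_pmf (if n = 0 then return_pmf s else K (\<omega> (n - 1)))"

interpretation chain: Ionescu_Tulcea "chain_step K s" "\<lambda>_. count_space UNIV"
  for K :: "'s \<Rightarrow> 's pmf" and s :: 's
proof (rule Ionescu_Tulcea.intro)
  fix i
  show "chain_step K s i \<in> measurable (PiM {0..<i} (\<lambda>_. count_space UNIV))
          (subprob_algebra (count_space UNIV))"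
  proof (cases "i = 0")
    case True
    then show ?thesis
      by (auto simp: chain_step_def[abs_def] space_subprob_algebra
               intro!: measurable_const prob_space_imp_subprob_space measure_pmf.prob_space_axioms)
  next
    case False
    have "(\<lambda>\<omega>. measure_pmf (K (\<omega> (i - 1)))) \<in> measurable (PiM {0..<i} (\<lambda>_. count_space UNIV))
          (subprob_algebra (count_space UNIV))"
    proof (rule measurable_compose[where N = "count_space UNIV" and g = "\<lambda>z. measure_pmf (K z)"])
      show "(\<lambda>\<omega>. \<omega> (i - 1)) \<in> measurable (PiM {0..<i} (\<lambda>_. count_space UNIV)) (count_space UNIV)"
        using False by (intro measurable_component_singleton) auto
    qed (auto simp: space_subprob_algebra
              intro!: prob_space_imp_subprob_space measure_pmf.prob_space_axioms)
    with False show ?thesis by (simp add: chain_step_def[abs_def])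
  qed
next
  show "prob_space (chain_step K s i x)" for i x
    unfolding chain_step_def by (rule measure_pmf.prob_space_axioms)
qed

definition chain_measure :: "('s \<Rightarrow> 's pmf) \<Rightarrow> 's \<Rightarrow> (nat \<Rightarrow> 's) measure" where
  "chain_measure K s = chain.PF.lim K s"


section \<open>Constants of the model and the twisted free process\<close>

definition s1 :: "real \<Rightarrow> real \<Rightarrow> real \<Rightarrow> real \<Rightarrow> real" where
  "s1 l \<mu> \<alpha> \<beta> = (\<mu> - l - \<beta> - \<alpha>)\<^sup>2 + 4 * \<alpha> * \<mu>"

definition gamma1 :: "real \<Rightarrow> real \<Rightarrow> real \<Rightarrow> real \<Rightarrow> real" where
  "gamma1 l \<mu> \<alpha> \<beta> = 2 * l / (l + \<beta> + \<mu> + \<alpha> - sqrt (s1 l \<mu> \<alpha> \<beta>))"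

definition gamma2 :: "real \<Rightarrow> real \<Rightarrow> real \<Rightarrow> real \<Rightarrow> real" where
  "gamma2 l \<mu> \<alpha> \<beta> = 2 * l / (l + \<beta> + \<mu> + \<alpha> + sqrt (s1 l \<mu> \<alpha> \<beta>))"

definition G :: "real \<Rightarrow> real \<Rightarrow> real \<Rightarrow> real \<Rightarrow> real" where
  "G l \<mu> \<alpha> \<beta> = (l + \<beta> - \<mu> - \<alpha> + sqrt (s1 l \<mu> \<alpha> \<beta>)) / 2
     + 2 * \<alpha> * \<beta> / (l + \<beta> - \<mu> - \<alpha> + sqrt (s1 l \<mu> \<alpha> \<beta>))"

text \<open>\<open>gamma2\<close> is the faster decay rate, written \<open>\<gamma>\<close> without index in the asymptotics.
  In the following, \<open>c\<close> is the uniformization constant.\<close>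

definition d1 :: "real \<Rightarrow> real \<Rightarrow> real \<Rightarrow> real \<Rightarrow> real \<Rightarrow> real" where
  "d1 l \<mu> \<alpha> \<beta> c = 1 / c *
     ((l + \<beta> + \<mu> + \<alpha> - sqrt (s1 l \<mu> \<alpha> \<beta>)) / 2
      - 1 / G l \<mu> \<alpha> \<beta> * l * \<mu> *
        ((l + \<beta> - \<mu> - \<alpha> + sqrt (s1 l \<mu> \<alpha> \<beta>)) / (l + \<beta> + \<mu> + \<alpha> - sqrt (s1 l \<mu> \<alpha> \<beta>))))"

fun free_kernel ::
  "real \<Rightarrow> real \<Rightarrow> real \<Rightarrow> real \<Rightarrow> real \<Rightarrow> int \<times> status \<Rightarrow> int \<times> status \<Rightarrow> real" where
  "free_kernel l \<mu> \<alpha> \<beta> c (m, Up) (n, Up) =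
     (if n = m + 1 then l / c else if n = m - 1 then \<mu> / c
      else if n = m then 1 - (l + \<mu> + \<alpha>) / c else 0)"
| "free_kernel l \<mu> \<alpha> \<beta> c (m, Down) (n, Down) =
     (if n = m + 1 then l / c else if n = m then 1 - (l + \<beta>) / c else 0)"
| "free_kernel l \<mu> \<alpha> \<beta> c (m, Up) (n, Down) = (if n = m then \<alpha> / c else 0)"
| "free_kernel l \<mu> \<alpha> \<beta> c (m, Down) (n, Up) = (if n = m then \<beta> / c else 0)"

fun harm :: "real \<Rightarrow> real \<Rightarrow> real \<Rightarrow> real \<Rightarrow> int \<times> status \<Rightarrow> real" where
  "harm l \<mu> \<alpha> \<beta> (x, Up) = gamma1 l \<mu> \<alpha> \<beta> powi (- x)"
| "harm l \<mu> \<alpha> \<beta> (x, Down) =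
     gamma1 l \<mu> \<alpha> \<beta> powi (- x) * (2 * \<beta> / (l + \<beta> - \<mu> - \<alpha> + sqrt (s1 l \<mu> \<alpha> \<beta>)))"

definition twisted_kernel ::
  "real \<Rightarrow> real \<Rightarrow> real \<Rightarrow> real \<Rightarrow> real \<Rightarrow> int \<times> status \<Rightarrow> int \<times> status \<Rightarrow> real" where
  "twisted_kernel l \<mu> \<alpha> \<beta> c z w =
     free_kernel l \<mu> \<alpha> \<beta> c z w * harm l \<mu> \<alpha> \<beta> w / harm l \<mu> \<alpha> \<beta> z"

text \<open>The lemma \<open>pmf_twisted\<close> below shows that \<open>embed_pmf\<close> is applied to a probability mass function
  for all positive parameters and \<open>c \<ge> l + \<mu> + \<alpha> + \<beta>\<close>.\<close>

definition twisted ::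
  "real \<Rightarrow> real \<Rightarrow> real \<Rightarrow> real \<Rightarrow> real \<Rightarrow> int \<times> status \<Rightarrow> (int \<times> status) pmf" where
  "twisted l \<mu> \<alpha> \<beta> c z = embed_pmf (twisted_kernel l \<mu> \<alpha> \<beta> c z)"

definition escape :: "real \<Rightarrow> real \<Rightarrow> real \<Rightarrow> real \<Rightarrow> real \<Rightarrow> int \<times> status \<Rightarrow> real" where
  "escape l \<mu> \<alpha> \<beta> c z =
     measure (chain_measure (twisted l \<mu> \<alpha> \<beta> c) z) {\<omega>. \<forall>n\<ge>1. fst (\<omega> n) > 0}"

definition eta1 ::
  "real \<Rightarrow> real \<Rightarrow> real \<Rightarrow> real \<Rightarrow> real \<Rightarrow> (nat \<times> status) pmf \<Rightarrow> real" where
  "eta1 l \<mu> \<alpha> \<beta> c p =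
     (\<Sum>\<sigma>\<in>{Up, Down}. pmf p (0, \<sigma>) * harm l \<mu> \<alpha> \<beta> (0, \<sigma>) * escape l \<mu> \<alpha> \<beta> c (0, \<sigma>))"

definition C1_Up ::
  "real \<Rightarrow> real \<Rightarrow> real \<Rightarrow> real \<Rightarrow> real \<Rightarrow> (nat \<times> status) pmf \<Rightarrow> real" where
  "C1_Up l \<mu> \<alpha> \<beta> c p =
     eta1 l \<mu> \<alpha> \<beta> c p / d1 l \<mu> \<alpha> \<beta> c * (1 / G l \<mu> \<alpha> \<beta>)
       * ((l + \<beta> - \<mu> - \<alpha> + sqrt (s1 l \<mu> \<alpha> \<beta>)) / 2)"


section \<open>The twisted kernel is stochastic\<close>

context
  fixes l \<mu> \<alpha> \<beta> :: real
  assumes pos: "l > 0" "\<mu> > 0" "\<alpha> > 0" "\<beta> > 0"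
begin

lemma s1_bounds:
  "\<bar>l + \<beta> - \<mu> - \<alpha>\<bar> < sqrt (s1 l \<mu> \<alpha> \<beta>)" "sqrt (s1 l \<mu> \<alpha> \<beta>) < l + \<beta> + \<mu> + \<alpha>"
proof -
  let ?r = "sqrt (s1 l \<mu> \<alpha> \<beta>)"
  have alt: "s1 l \<mu> \<alpha> \<beta> = (l + \<beta> - \<mu> - \<alpha>)\<^sup>2 + 4 * \<alpha> * (l + \<beta>)"
    "s1 l \<mu> \<alpha> \<beta> = (l + \<beta> + \<mu> + \<alpha>)\<^sup>2 - 4 * \<mu> * (l + \<beta>)"
    by (simp_all add: s1_def power2_eq_square algebra_simps)
  have "sqrt ((l + \<beta> - \<mu> - \<alpha>)\<^sup>2) < ?r"
    unfolding alt(1) using pos by (intro real_sqrt_less_mono) simp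
  then show "\<bar>l + \<beta> - \<mu> - \<alpha>\<bar> < ?r" by simp
  have "?r < sqrt ((l + \<beta> + \<mu> + \<alpha>)\<^sup>2)"
    unfolding alt(2) using pos by (intro real_sqrt_less_mono) simp
  then show "?r < l + \<beta> + \<mu> + \<alpha>" using pos by simp
qed

lemma gamma1_pos: "gamma1 l \<mu> \<alpha> \<beta> > 0"
  using s1_bounds pos by (simp add: gamma1_def)

lemma harm_pos: "harm l \<mu> \<alpha> \<beta> z > 0"
  using s1_bounds pos gamma1_pos by (cases z; cases "snd z") auto

lemma twisted_kernel_nonneg:
  assumes "c \<ge> l + \<mu> + \<alpha> + \<beta>"
  shows "twisted_kernel l \<mu> \<alpha> \<beta> c z w \<ge> 0"
proof -
  have "free_kernel l \<mu> \<alpha> \<beta> c z w \<ge> 0"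
    using pos assms
    by (cases "(l, \<mu>, \<alpha>, \<beta>, c, z, w)" rule: free_kernel.cases) (auto simp: field_simps)
  then show ?thesis
    using harm_pos[of z] harm_pos[of w] by (simp add: twisted_kernel_def)
qed

lemma twisted_kernel_sum:
  assumes c: "c \<ge> l + \<mu> + \<alpha> + \<beta>"
  shows "(\<Sum>w\<in>{fst z - 1..fst z + 1} \<times> {Up, Down}. twisted_kernel l \<mu> \<alpha> \<beta> c z w) = 1"
proof -
  obtain m \<sigma> where z: "z = (m, \<sigma>)" by (cases z)
  define g where "g = gamma1 l \<mu> \<alpha> \<beta>"
  define a where "a = (l + \<beta> - \<mu> - \<alpha> + sqrt (s1 l \<mu> \<alpha> \<beta>)) / 2"
  have g: "g > 0" using gamma1_pos by (simp add: g_def)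
  have a: "a > 0" using s1_bounds by (simp add: a_def)
  have b: "l + \<beta> - a > 0" using s1_bounds by (simp add: a_def)
  have g_a: "g = l / (l + \<beta> - a)"
    using b by (simp add: g_def gamma1_def a_def field_simps)
  have "(2 * a - (l + \<beta> - \<mu> - \<alpha>))\<^sup>2 = s1 l \<mu> \<alpha> \<beta>"
  proof -
    have "2 * a - (l + \<beta> - \<mu> - \<alpha>) = sqrt (s1 l \<mu> \<alpha> \<beta>)" by (simp add: a_def field_simps)
    moreover have "s1 l \<mu> \<alpha> \<beta> \<ge> 0" using pos by (simp add: s1_def)
    ultimately show ?thesis by simp
  qed
  then have quad: "a * a = a * (l + \<beta> - \<mu> - \<alpha>) + \<alpha> * (l + \<beta>)"
    by (simp add: s1_def power2_eq_square algebra_simps)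
  have hD: "harm l \<mu> \<alpha> \<beta> (x, Down) = g powi (- x) * (\<beta> / a)" for x
    using a by (simp add: g_def a_def field_simps)
  have hU: "harm l \<mu> \<alpha> \<beta> (x, Up) = g powi (- x)" for x
    by (simp add: g_def)
  have pw: "g powi (- x - 1) = g powi (- x) / g" "g powi (- 1 - x) = g powi (- x) / g"
    "g powi (1 - x) = g powi (- x) * g" for x
    using g by (simp_all add: power_int_diff power_int_minus field_simps)
  have pp: "g powi (- m) > 0" using g by simp
  have c0: "c > 0" using c pos by simp
  have set: "{m - 1..m + 1} = {m - 1, m, m + 1}" by auto
  have lg: "l / g = l + \<beta> - a" using pos by (simp add: g_a)
  have U: "l / g + \<mu> * g + \<alpha> * \<beta> / a = l + \<mu> + \<alpha>"
  proof -
    define b where "b = l + \<beta> - a"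
    have b0: "b \<noteq> 0" "a \<noteq> 0" using a b by (simp_all add: b_def)
    have "b * (b * a) + \<mu> * l * a + \<alpha> * \<beta> * b = (l + \<mu> + \<alpha>) * (b * a)"
      using quad unfolding b_def by algebra
    then have "(b * (b * a) + \<mu> * l * a + \<alpha> * \<beta> * b) / (b * a) = l + \<mu> + \<alpha>"
      using b0 by simp
    moreover have "(b * (b * a) + \<mu> * l * a + \<alpha> * \<beta> * b) / (b * a) = b + \<mu> * (l / b) + \<alpha> * \<beta> / a"
      using b0 by (simp add: add_divide_distrib)
    ultimately have "(l + \<beta> - a) + \<mu> * (l / (l + \<beta> - a)) + \<alpha> * \<beta> / a = l + \<mu> + \<alpha>"
      by (simp add: b_def)
    then show ?thesis by (simp only: lg) (simp only: g_a)
  qed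
  show ?thesis
  proof (cases \<sigma>)
    case Up
    have "(\<Sum>w\<in>{fst z - 1..fst z + 1} \<times> {Up, Down}. twisted_kernel l \<mu> \<alpha> \<beta> c z w)
        = \<mu> * g / c + (1 - (l + \<mu> + \<alpha>) / c) + l / g / c + \<alpha> * \<beta> / a / c"
      unfolding z Up fst_conv set using pp g
      by (simp add: sum.cartesian_product[symmetric] twisted_kernel_def hU hD pw ac_simps
               del: harm.simps)
    also have "\<dots> = 1 + ((l / g + \<mu> * g + \<alpha> * \<beta> / a) - (l + \<mu> + \<alpha>)) / c"
      by (simp add: add_divide_distrib diff_divide_distrib)
    finally show ?thesis using U by simp
  next
    case Down
    have "(\<Sum>w\<in>{fst z - 1..fst z + 1} \<times> {Up, Down}. twisted_kernel l \<mu> \<alpha> \<beta> c z w)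
        = (1 - (l + \<beta>) / c) + l / g / c + a / c"
      unfolding z Down fst_conv set using pp g a pos
      by (simp add: sum.cartesian_product[symmetric] twisted_kernel_def hU hD pw ac_simps
               del: harm.simps)
    also have "\<dots> = 1" using lg by (simp add: add_divide_distrib diff_divide_distrib)
    finally show ?thesis .
  qed
qed

lemma pmf_twisted:
  assumes c: "c \<ge> l + \<mu> + \<alpha> + \<beta>"
  shows "pmf (twisted l \<mu> \<alpha> \<beta> c z) w = twisted_kernel l \<mu> \<alpha> \<beta> c z w"
  unfolding twisted_def
proof (rule pmf_embed_pmf)
  let ?A = "{fst z - 1..fst z + 1} \<times> {Up, Down}"
  have supp: "w \<in> ?A" if "twisted_kernel l \<mu> \<alpha> \<beta> c z w \<noteq> 0" for w
    using that by (cases "(l, \<mu>, \<alpha>, \<beta>, c, z, w)" rule: free_kernel.cases)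
      (auto simp: twisted_kernel_def split: if_splits)
  have zero: "ennreal (twisted_kernel l \<mu> \<alpha> \<beta> c z w) = 0" if "w \<notin> ?A" for w
    using supp[of w] that by (metis ennreal_0)
  have "(\<integral>\<^sup>+w. ennreal (twisted_kernel l \<mu> \<alpha> \<beta> c z w) \<partial>count_space UNIV)
      = (\<Sum>w\<in>?A. ennreal (twisted_kernel l \<mu> \<alpha> \<beta> c z w))"
    by (rule nn_integral_count_space'[OF _ zero]) simp_all
  also have "\<dots> = 1"
    using twisted_kernel_sum[OF c, of z] twisted_kernel_nonneg[OF c] by (simp add: sum_ennreal)
  finally show "(\<integral>\<^sup>+w. ennreal (twisted_kernel l \<mu> \<alpha> \<beta> c z w) \<partial>count_space UNIV) = 1" .
qed (use twisted_kernel_nonneg[OF c] in auto)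

end

end

theory Submission
  imports Defs
begin

text \<open>The cut equation \<open>\<mu> * \<pi>(k+1,U) = l * (\<pi>(k,U) + \<pi>(k,D))\<close> and the balance equations at the Down
  states yield a linear recurrence of order two for \<open>\<pi>(k,U)\<close>, whose characteristic roots are \<open>gamma1\<close>
  and \<open>gamma2\<close>. So \<open>\<pi>(k,U) = A * gamma1^k + B * gamma2^k\<close> exactly, with \<open>A, B > 0\<close> computed from
  \<open>\<pi>(0,U) = \<beta> / (\<alpha> + \<beta>) - l / \<mu>\<close>, and \<open>B\<close> serves as the constant \<open>C(U)\<close>; since \<open>gamma1\<close> tends
  to \<open>l / (l + \<beta>)\<close> as \<open>\<alpha>\<close> tends to 0, \<open>A / B\<close> tends to 0.

  It remains to see that \<open>C1_Up\<close> equals \<open>A\<close>, for which the escape probabilities are needed in closed form.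
  The function \<open>1 / harm\<close> is harmonic for the twisted chain, equals 1 at \<open>(0, Up)\<close>, the only state
  through which level 0 is entered from above, and vanishes at infinity. By a maximum
  principle it is the probability of ever reaching level 0 from a positive level.\<close>

section \<open>Confinement of a Markov chain to a set\<close>

lemma sets_chain_measure: "sets (chain_measure K s) = sets (PiM UNIV (\<lambda>_. count_space UNIV))"
  unfolding chain_measure_def by (rule chain.PF.sets_lim)

lemma space_chain_measure: "space (chain_measure K s) = UNIV"
  using sets_eq_imp_space_eq[OF sets_chain_measure, of K s] by (auto simp: space_PiM)

text \<open>The index set is left open because the event is needed both on finitely many coordinates
  and on the whole path space.\<close>

lemma sets_stay:
  fixes n :: nat
  assumes "{1..n} \<subseteq> I"
  shows "{\<omega> \<in> space (PiM I (\<lambda>_. count_space UNIV)). \<forall>j\<in>{1..n}. \<omega> j \<in> A}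
    \<in> sets (PiM I (\<lambda>_. count_space UNIV))"
proof -
  have "{\<omega> \<in> space (PiM I (\<lambda>_. count_space UNIV)). \<omega> j \<in> A} \<in> sets (PiM I (\<lambda>_. count_space UNIV))"
    if "j \<in> {1..n}" for j
    by (rule measurable_sets_Collect[OF measurable_component_singleton]) (use that assms in auto)
  then show ?thesis by (intro sets.sets_Collect_finite_All) (auto simp del: One_nat_def)
qed

text \<open>\<open>chain.C K s 0 (Suc n)\<close> is the law of the coordinates 0 to
  \<open>n\<close>. Integrating out the last one replaces \<open>g\<close> by its image under the
  kernel restricted to \<open>A\<close>, so the induction has to run over all
  \<open>g\<close>.\<close>

lemma nn_integral_chain_C:
  fixes A :: "'s set" and g :: "'s \<Rightarrow> ennreal"
  shows "(\<integral>\<^sup>+\<omega>. (\<Prod>j\<in>{1..n}. indicator A (\<omega> j)) * g (\<omega> n) \<partial>chain.C K s 0 (Suc n) (\<lambda>_. undefined))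
    = ((\<lambda>f z. \<integral>\<^sup>+w. indicator A w * f w \<partial>measure_pmf (K z)) ^^ n) g s"
proof (induction n arbitrary: g)
  have comp: "(\<lambda>\<omega>. f (\<omega> j)) \<in> borel_measurable (PiM {0..<Suc n} (\<lambda>_. count_space UNIV))"
    if "j \<le> n" for f :: "'s \<Rightarrow> ennreal" and j n
    by (rule measurable_compose[OF measurable_component_singleton]) (use that in auto)
  have meas[measurable]: "(\<lambda>\<omega>. (\<Prod>j\<in>{1..n}. indicator A (\<omega> j)) * g (\<omega> n))
      \<in> borel_measurable (PiM {0..<Suc n} (\<lambda>_. count_space UNIV))" for n and g :: "'s \<Rightarrow> ennreal"
    by (intro borel_measurable_times_ennreal borel_measurable_prod_ennreal comp) auto
  note [measurable_cong] = chain.sets_C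
  have u: "(\<lambda>_. undefined) \<in> space (PiM {0..<0::nat} (\<lambda>_. count_space UNIV :: 's measure))"
    by (simp add: space_PiM)
  \<comment> \<open>Disintegration of the law of the coordinates 0 to \<open>n\<close> along the
    last of them.\<close>
  have step: "(\<integral>\<^sup>+\<omega>. (\<Prod>j\<in>{1..n}. indicator A (\<omega> j)) * g (\<omega> n) \<partial>chain.C K s 0 (Suc n) (\<lambda>_. undefined))
    = (\<integral>\<^sup>+\<omega>. (\<integral>\<^sup>+w. (\<Prod>j\<in>{1..n}. indicator A (fun_upd \<omega> n w j)) * g w \<partial>chain_step K s n \<omega>)
        \<partial>chain.C K s 0 n (\<lambda>_. undefined))" for n and g :: "'s \<Rightarrow> ennreal"
  proof -
    have "(\<integral>\<^sup>+\<omega>. (\<Prod>j\<in>{1..n}. indicator A (\<omega> j)) * g (\<omega> n) \<partial>chain.C K s 0 (Suc n) (\<lambda>_. undefined))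
      = (\<integral>\<^sup>+\<omega>. (\<integral>\<^sup>+\<omega>'. (\<Prod>j\<in>{1..n}. indicator A (\<omega>' j)) * g (\<omega>' n) \<partial>chain.eP K s n \<omega>)
        \<partial>chain.C K s 0 n (\<lambda>_. undefined))"
      unfolding chain.C.simps add_0
    proof (rule nn_integral_bind)
      have "measurable (chain.C K s 0 n (\<lambda>_. undefined)) = (measurable (PiM {0..<n} (\<lambda>_. count_space UNIV))
          :: (nat \<Rightarrow> 's) measure measure \<Rightarrow> _)"
        using chain.sets_C[OF u, of K s n] by (intro ext measurable_cong_sets) simp_all
      then show "chain.eP K s n \<in> measurable (chain.C K s 0 n (\<lambda>_. undefined))
          (subprob_algebra (PiM {0..<Suc n} (\<lambda>_. count_space UNIV)))"
        using chain.measurable_eP[of K s n] by simp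
    qed measurable
    also have "\<dots> = (\<integral>\<^sup>+\<omega>. (\<integral>\<^sup>+w. (\<Prod>j\<in>{1..n}. indicator A (fun_upd \<omega> n w j)) * g w \<partial>chain_step K s n \<omega>)
        \<partial>chain.C K s 0 n (\<lambda>_. undefined))"
      by (intro nn_integral_cong, subst chain.nn_integral_eP[OF _ meas]) (simp_all add: chain.space_C[OF u])
    finally show ?thesis .
  qed
  {
    case 0
    have "chain_step K s 0 \<omega> = measure_pmf (return_pmf s)" for \<omega>
      by (simp add: chain_step_def)
    then show ?case unfolding step by simp
  next
    case (Suc n)
    have "(\<integral>\<^sup>+w. (\<Prod>j\<in>{1..Suc n}. indicator A (fun_upd \<omega> (Suc n) w j)) * g w \<partial>chain_step K s (Suc n) \<omega>)
      = (\<Prod>j\<in>{1..n}. indicator A (\<omega> j)) * (\<integral>\<^sup>+w. indicator A w * g w \<partial>measure_pmf (K (\<omega> n)))" for \<omega>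
      by (simp add: chain_step_def nn_integral_cmult[symmetric] mult_ac
        atLeastAtMostSuc_conv)
    then show ?case
      using step[of "Suc n" g] Suc.IH[of "\<lambda>z. \<integral>\<^sup>+w. indicator A w * g w \<partial>measure_pmf (K z)"]
      by (simp add: funpow_Suc_right del: funpow.simps chain.C.simps)
  }
qed

text \<open>The event is a cylinder over the coordinates 0 to \<open>n\<close>, so its measure is
  read off from the finite-dimensional law.\<close>

lemma emeasure_chain_stay:
  fixes A :: "'s set"
  shows "emeasure (chain_measure K s) {\<omega>. \<forall>j\<in>{1..n}. \<omega> j \<in> A}
    = ((\<lambda>f z. \<integral>\<^sup>+w. indicator A w * f w \<partial>measure_pmf (K z)) ^^ n) (\<lambda>_. 1) s"
proof -
  let ?P = "PiM {0..<Suc n} (\<lambda>_. count_space UNIV :: 's measure)"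
  let ?X = "{\<omega> \<in> space ?P. \<forall>j\<in>{1..n}. \<omega> j \<in> A}"
  have X: "?X \<in> sets ?P" by (rule sets_stay) auto
  have emb: "prod_emb {0..<Suc n} (\<lambda>_. count_space UNIV) {0..<Suc n} ?X = ?X"
    by (rule prod_emb_id) (auto simp: space_PiM)
  have "{\<omega>. \<forall>j\<in>{1..n}. \<omega> j \<in> A} = prod_emb UNIV (\<lambda>_. count_space UNIV) {0..<Suc n} ?X"
    by (auto simp: prod_emb_def space_PiM)
  then have "emeasure (chain_measure K s) {\<omega>. \<forall>j\<in>{1..n}. \<omega> j \<in> A}
      = emeasure (chain.C K s 0 (Suc n) (\<lambda>_. undefined)) ?X"
    using X unfolding chain_measure_def
    by (simp add: chain.lim chain.emeasure_CI[where n = "Suc n"]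
      emb del: chain.C.simps One_nat_def)
  also have "\<dots> = (\<integral>\<^sup>+\<omega>. (\<Prod>j\<in>{1..n}. indicator A (\<omega> j)) * 1 \<partial>chain.C K s 0 (Suc n) (\<lambda>_. undefined))"
  proof -
    have u: "(\<lambda>_. undefined) \<in> space (PiM {0..<0::nat} (\<lambda>_. count_space UNIV :: 's measure))"
      by (simp add: space_PiM)
    have "indicator ?X \<omega> = (\<Prod>j\<in>{1..n}. indicator A (\<omega> j) :: ennreal)" if "\<omega> \<in> space ?P" for \<omega>
      using that by (auto simp: indicator_def)
    then show ?thesis
      using X chain.space_C[OF u, of K s "Suc n"] chain.sets_C[OF u, of K s "Suc n"]
      by (subst nn_integral_indicator[symmetric], simp del: chain.C.simps, intro nn_integral_cong)
         (simp del: chain.C.simps One_nat_def)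
  qed
  finally show ?thesis using nn_integral_chain_C[where g = "\<lambda>_. 1"] by simp
qed

text \<open>Confinement during zero steps is the sure event, so \<open>n = 0\<close> in the
  preceding formula gives total mass 1.\<close>

lemma prob_space_chain_measure: "prob_space (chain_measure K s)"
  using emeasure_chain_stay[of K s 0] by (intro prob_spaceI) (simp add: space_chain_measure)

text \<open>Time 0 is exempt, so the start may lie outside \<open>A\<close>, as level 0 does in the
  escape probabilities.\<close>

definition stay :: "('s \<Rightarrow> 's pmf) \<Rightarrow> 's set \<Rightarrow> nat \<Rightarrow> 's \<Rightarrow> real" where
  "stay K A n z = measure (chain_measure K z) {\<omega>. \<forall>j\<in>{1..n}. \<omega> j \<in> A}"

lemma stay_0: "stay K A 0 z = 1"
proof -
  interpret prob_space "chain_measure K z" by (rule prob_space_chain_measure)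
  show ?thesis using prob_space by (simp add: stay_def space_chain_measure)
qed

lemma stay_bounds: "0 \<le> stay K A n z" "stay K A n z \<le> 1"
  by (simp_all add: stay_def prob_space.prob_le_1[OF prob_space_chain_measure])

text \<open>First-step analysis: the outermost application of the operator in
  \<open>emeasure_chain_stay\<close> is the first step of the chain.\<close>

lemma stay_Suc:
  "stay K A (Suc n) z = measure_pmf.expectation (K z) (\<lambda>w. indicator A w * stay K A n w)"
proof -
  interpret prob_space "chain_measure K w" for w by (rule prob_space_chain_measure)
  have "ennreal (stay K A (Suc n) z) = (\<integral>\<^sup>+w. indicator A w * ennreal (stay K A n w) \<partial>measure_pmf (K z))"
    by (simp add: stay_def emeasure_eq_measure[symmetric] emeasure_chain_stay del: One_nat_def)
  also have "\<dots> = (\<integral>\<^sup>+w. ennreal (indicator A w * stay K A n w) \<partial>measure_pmf (K z))"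
    by (intro nn_integral_cong) (auto simp: indicator_def)
  also have "\<dots> = ennreal (measure_pmf.expectation (K z) (\<lambda>w. indicator A w * stay K A n w))"
    using stay_bounds[of K A n]
    by (intro nn_integral_eq_integral measure_pmf.integrable_const_bound[where B = 1])
       (auto simp: indicator_def)
  finally show ?thesis
    by (subst (asm) ennreal_inj) (simp_all add: stay_bounds Bochner_Integration.integral_nonneg)
qed

definition stay_forever :: "('s \<Rightarrow> 's pmf) \<Rightarrow> 's set \<Rightarrow> 's \<Rightarrow> real" where
  "stay_forever K A z = measure (chain_measure K z) {\<omega>. \<forall>n\<ge>1. \<omega> n \<in> A}"

lemma stay_tendsto: "(\<lambda>n. stay K A n z) \<longlonglongrightarrow> stay_forever K A z"
proof -
  interpret prob_space "chain_measure K z" by (rule prob_space_chain_measure)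
  have "{\<omega>. \<forall>j\<in>{1..n}. \<omega> j \<in> A} \<in> sets (chain_measure K z)" for n
    using sets_stay[of n UNIV A] by (simp add: sets_chain_measure space_PiM)
  then have "(\<lambda>n. stay K A n z) \<longlonglongrightarrow> prob (\<Inter>n. {\<omega>. \<forall>j\<in>{1..n}. \<omega> j \<in> A})"
    unfolding stay_def by (intro finite_Lim_measure_decseq) (auto simp: decseq_def)
  moreover have "(\<Inter>n::nat. {\<omega>. \<forall>j\<in>{1..n}. \<omega> j \<in> A}) = {\<omega>. \<forall>n\<ge>1. \<omega> n \<in> A}"
    by (auto simp del: One_nat_def) (metis atLeastAtMost_iff order_refl)
  ultimately show ?thesis by (simp add: stay_forever_def)
qed

lemma stay_forever_bounds: "0 \<le> stay_forever K A z" "stay_forever K A z \<le> 1"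
  by (simp_all add: stay_forever_def prob_space.prob_le_1[OF prob_space_chain_measure])

text \<open>The first-step equation passes to the limit by dominated convergence with bound
  1.\<close>

lemma stay_forever_step:
  "stay_forever K A z = measure_pmf.expectation (K z) (\<lambda>w. indicator A w * stay_forever K A w)"
proof (rule LIMSEQ_unique)
  show "(\<lambda>n. stay K A (Suc n) z) \<longlonglongrightarrow> stay_forever K A z"
    using stay_tendsto by (rule LIMSEQ_Suc)
  show "(\<lambda>n. stay K A (Suc n) z)
      \<longlonglongrightarrow> measure_pmf.expectation (K z) (\<lambda>w. indicator A w * stay_forever K A w)"
    unfolding stay_Suc
    by (rule integral_dominated_convergence[where w = "\<lambda>_. 1"])
       (auto intro!: tendsto_mult stay_tendsto simp: indicator_def stay_bounds)
qed

text \<open>Since \<open>f\<close> is at most 1, iterating the subharmonic inequality bounds it by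
  the \<open>n\<close>-fold restricted kernel applied to 1, which is
  \<open>stay K A n\<close>.\<close>

lemma stay_forever_ge:
  fixes f :: "'s \<Rightarrow> real"
  assumes f: "\<And>z. f z \<le> 1" "\<And>z. z \<in> A \<Longrightarrow> f z \<ge> 0"
    and sub: "\<And>z. z \<in> A \<Longrightarrow> f z \<le> measure_pmf.expectation (K z) (\<lambda>w. indicator A w * f w)"
    and z: "z \<in> A"
  shows "f z \<le> stay_forever K A z"
proof (rule LIMSEQ_le_const[OF stay_tendsto])
  have "f z \<le> stay K A n z" if "z \<in> A" for n z
    using that
  proof (induction n arbitrary: z)
    case 0
    then show ?case using f by (simp add: stay_0)
  next
    case (Suc n)
    have "f z \<le> measure_pmf.expectation (K z) (\<lambda>w. indicator A w * f w)"
      using sub Suc.prems .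
    also have "\<dots> \<le> stay K A (Suc n) z"
      unfolding stay_Suc using f Suc.IH stay_bounds[of K A n]
      by (intro integral_mono measure_pmf.integrable_const_bound[where B = 1])
         (auto simp: indicator_def)
    finally show ?case .
  qed
  then show "\<exists>N. \<forall>n\<ge>N. f z \<le> stay K A n z" using z by blast
qed

section \<open>The unreliable queue\<close>

text \<open>The identity \<open>C1_Up = A\<close>, with \<open>\<alpha>\<close> and \<open>\<beta>\<close> expressed through the twisted rates \<open>a\<close> and \<open>b\<close> so that no
  square root occurs.\<close>

lemma C1_identity:
  fixes a b l \<mu> \<alpha> \<beta> c u :: real
  assumes pos: "0 < a" "0 < l" "l < b" "b < \<mu>" "0 < c"
    and \<alpha>: "\<alpha> = a * (\<mu> - b) / b" and \<beta>: "\<beta> = a + b - l"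
  shows "(u * (b / c * (1 - l / b)) + \<alpha> / (l + \<beta>) * u * (\<beta> / a) * (b / c * (1 - l / b * (a / \<beta>))))
      / ((b - l * \<mu> * (a / b) / (a + \<alpha> * \<beta> / a)) / c) * (1 / (a + \<alpha> * \<beta> / a)) * a
    = u * (l / b - l / (l + \<beta>)) / (l / b - l * b / (\<mu> * (l + \<beta>)))"
    (is "?eta / ((b - ?x / ?G) / c) * (1 / ?G) * a = _")
proof -
  let ?D = "\<mu> * (a + b) - b * b"
  have pos': "0 < b" "0 < \<mu>" "0 < \<beta>" using pos by (simp_all add: \<beta>)
  have D: "?D > 0"
    using mult_strict_mono[OF pos(4), of b "a + b"] pos pos' by simp
  have eD: "b / c * (1 - l / b * (a / \<beta>)) = (a + b) * (b - l) / (\<beta> * c)"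
  proof -
    have "b / c * (1 - l / b * (a / \<beta>)) = (\<beta> * b - l * a) / (\<beta> * c)"
      using pos pos' by (simp add: field_simps)
    also have "\<beta> * b - l * a = (a + b) * (b - l)" by (simp add: \<beta> algebra_simps)
    finally show ?thesis .
  qed
  have "?eta = u * ((b - l) / c) + \<alpha> / (a + b) * u * (\<beta> / a) * ((a + b) * (b - l) / (\<beta> * c))"
    unfolding eD using pos pos' by (simp add: \<beta> field_simps)
  also have "\<dots> = u * ((b - l) / c) * (1 + \<alpha> / a)"
  proof -
    \<comment> \<open>\<open>k\<close> stands for \<open>a + b\<close>, so that simplification
      cancels the sum as an atom instead of expanding it.\<close>
    have "\<alpha> / k * u * (\<beta> / a) * (k * (b - l) / (\<beta> * c)) = u * ((b - l) / c) * (\<alpha> / a)" if "k \<noteq> 0" for k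
      using that pos pos' by (simp add: field_simps)
    from this[of "a + b"] show ?thesis using pos pos' by (simp add: distrib_left)
  qed
  also have "1 + \<alpha> / a = \<mu> / b"
    using pos pos' by (simp add: \<alpha> field_simps)
  finally have eta: "?eta = u * ((b - l) * \<mu>) / (b * c)"
    by (simp add: mult_ac)
  have G: "?G > 0" using pos pos' by (simp add: \<alpha> add_pos_pos)
  have "?G * b = \<mu> * (a + b - l) - b * b + b * l"
  proof -
    have "?G * b = a * b + (\<mu> - b) * \<beta>" using pos pos' by (simp add: \<alpha> field_simps)
    then show ?thesis by (simp add: \<beta> algebra_simps)
  qed
  moreover have "(b - ?x / ?G) / c * ?G = (?G * b - ?x) / c"
  proof -
    have *: "(b - x / g) / c * g = (g * b - x) / c" if "g \<noteq> 0" for x g :: real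
      using that by (simp add: right_diff_distrib mult.commute[of _ g])
    show ?thesis by (rule *) (use G in simp)
  qed
  moreover have "(\<mu> * (a + b - l) - b * b + b * l - ?x) / c = (b - l) * ?D / (b * c)"
    using pos pos' by (simp add: field_simps)
  ultimately have dG: "(b - ?x / ?G) / c * ?G = (b - l) * ?D / (b * c)"
    by (simp only:)
  \<comment> \<open>Absorbing \<open>1 / ?G\<close> into the denominator makes \<open>dG\<close>
    applicable, which removes the nested fraction.\<close>
  have "?eta / ((b - ?x / ?G) / c) * (1 / ?G) * a = ?eta * a / ((b - ?x / ?G) / c * ?G)"
    by simp
  also have "\<dots> = u * (\<mu> * a / ?D)"
    unfolding eta dG using pos pos' by simp
  also have "\<mu> * a / ?D = (l / b - l / (a + b)) / (l / b - l * b / (\<mu> * (a + b)))"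
  proof -
    have "l / b - l / (a + b) = l * a / (b * (a + b))"
      using pos pos' by (simp add: field_simps)
    moreover have "l / b - l * b / (\<mu> * (a + b)) = l * ?D / (b * \<mu> * (a + b))"
    proof -
      have "l / b - l * b / (\<mu> * k) = l * (\<mu> * k - b * b) / (b * \<mu> * k)" if "k \<noteq> 0" for k
        using that pos pos' by (simp add: field_simps)
      then show ?thesis using pos pos' by simp
    qed
    ultimately show ?thesis using pos pos' by simp
  qed
  also have "a + b = l + \<beta>" by (simp add: \<beta>)
  finally show ?thesis by simp
qed

lemma stationary_sum_eq_0:
  assumes "stationary q p" "finite B" "\<And>z. z \<notin> B \<Longrightarrow> generator q z w = 0"
  shows "(\<Sum>z\<in>B. pmf p z * generator q z w) = 0"
proof (rule has_sum_unique)
  show "((\<lambda>z. pmf p z * generator q z w) has_sum (\<Sum>z\<in>B. pmf p z * generator q z w)) UNIV"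
    using assms by (intro has_sum_finite_neutralI) auto
  show "((\<lambda>z. pmf p z * generator q z w) has_sum 0) UNIV"
    using assms(1) by (simp add: stationary_def)
qed

section \<open>Algebra of the twisted rates and the two decay rates\<close>

locale unreliable_queue =
  fixes l \<mu> \<alpha> \<beta> :: real
  assumes pos: "l > 0" "\<mu> > 0" "\<alpha> > 0" "\<beta> > 0"
    and stable: "l < \<beta> / (\<alpha> + \<beta>) * \<mu>"
begin

text \<open>The twisted chain moves at rates \<open>b\<close> (arrival), \<open>\<mu> * l / b\<close> (service), \<open>\<alpha> * \<beta> / a\<close> (breakdown)
  and \<open>a\<close> (repair), all divided by the uniformization constant.\<close>

definition a :: real where "a = (l + \<beta> - \<mu> - \<alpha> + sqrt (s1 l \<mu> \<alpha> \<beta>)) / 2"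
definition b :: real where "b = l + \<beta> - a"

lemma a_pos: "a > 0" and b_pos: "b > 0"
  using s1_bounds[OF pos] by (simp_all add: a_def b_def field_simps)

lemma sqrt_s1: "l + \<beta> - \<mu> - \<alpha> + sqrt (s1 l \<mu> \<alpha> \<beta>) = 2 * a"
  "l + \<beta> + \<mu> + \<alpha> - sqrt (s1 l \<mu> \<alpha> \<beta>) = 2 * b"
  by (simp_all add: a_def b_def field_simps)

text \<open>Squaring the formula for \<open>a\<close> removes the square root; the algebra of the
  rates below rests on this quadratic equation.\<close>

lemma quad: "a * a = a * (l + \<beta> - \<mu> - \<alpha>) + \<alpha> * (l + \<beta>)"
proof -
  have "(2 * a - (l + \<beta> - \<mu> - \<alpha>))\<^sup>2 = s1 l \<mu> \<alpha> \<beta>"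
  proof -
    have "2 * a - (l + \<beta> - \<mu> - \<alpha>) = sqrt (s1 l \<mu> \<alpha> \<beta>)" by (simp add: a_def field_simps)
    moreover have "s1 l \<mu> \<alpha> \<beta> \<ge> 0" using pos by (simp add: s1_def)
    ultimately show ?thesis by simp
  qed
  then show ?thesis by (simp add: s1_def power2_eq_square algebra_simps)
qed

lemma stable': "l * (\<alpha> + \<beta>) < \<beta> * \<mu>"
  using stable pos by (simp add: field_simps)

text \<open>Here stability enters. The monic quadratic with root \<open>a\<close> takes the value
  \<open>\<beta> * \<mu> - l * (\<alpha> + \<beta>)\<close> at \<beta>, which is positive, and its
  other root is negative. The consequence \<open>b > l\<close> is what makes \<open>gamma1\<close>
  less than 1.\<close>

lemma a_less: "a < \<beta>"
proof -
  have "a * (a - (l + \<beta> - \<mu> - \<alpha>)) = \<alpha> * (l + \<beta>)"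
    using quad by (simp add: algebra_simps)
  then have "a * (a - (l + \<beta> - \<mu> - \<alpha>)) > 0"
    using pos by simp
  then have r: "a - (l + \<beta> - \<mu> - \<alpha>) > 0"
    using a_pos by (simp add: zero_less_mult_iff)
  have "(\<beta> - a) * (\<beta> + (a - (l + \<beta> - \<mu> - \<alpha>))) = \<beta> * \<mu> - l * (\<alpha> + \<beta>)"
    using quad by (simp add: algebra_simps)
  then have "(\<beta> - a) * (\<beta> + (a - (l + \<beta> - \<mu> - \<alpha>))) > 0"
    using stable' by simp
  then show ?thesis using r pos by (simp add: zero_less_mult_iff)
qed

lemma b_gt: "b > l" "b < l + \<beta>"
  using a_less a_pos by (simp_all add: b_def)

lemma beta_eq: "\<beta> = a + b - l"
  by (simp add: b_def)

lemma alpha_eq: "\<alpha> = a * (\<mu> - b) / b"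
proof -
  have "\<alpha> * b = a * (\<mu> - b)"
    using quad unfolding b_def by algebra
  then show ?thesis using b_pos by (simp add: field_simps)
qed

lemma b_less: "b < \<mu>"
proof -
  have "a * (\<mu> - b) / b > 0" using alpha_eq pos by simp
  then show ?thesis using a_pos b_pos by (simp add: zero_less_divide_iff zero_less_mult_iff)
qed

lemma gamma1_eq: "gamma1 l \<mu> \<alpha> \<beta> = l / b"
  by (simp add: gamma1_def sqrt_s1)

lemma b_root: "b * (l + \<beta> + \<mu> + \<alpha>) = \<mu> * (l + \<beta>) + b * b"
  using quad unfolding b_def by algebra

text \<open>By \<open>b_root\<close>, the quadratic with root \<open>b\<close> has
  \<open>\<mu> * (l + \<beta>) / b\<close> as its other root, and \<open>gamma2\<close> is
  \<open>l\<close> divided by that root.\<close>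

lemma gamma2_eq: "gamma2 l \<mu> \<alpha> \<beta> = l * b / (\<mu> * (l + \<beta>))"
proof -
  have "b * (l + \<beta> + \<mu> + \<alpha> - b) = \<mu> * (l + \<beta>)"
    using b_root by (simp add: algebra_simps)
  moreover have "gamma2 l \<mu> \<alpha> \<beta> = l / (l + \<beta> + \<mu> + \<alpha> - b)"
  proof -
    have "l + \<beta> + \<mu> + \<alpha> + sqrt (s1 l \<mu> \<alpha> \<beta>) = 2 * (l + \<beta> + \<mu> + \<alpha> - b)"
      by (simp add: a_def b_def field_simps)
    then show ?thesis 
      by (simp only: gamma2_def mult_divide_mult_cancel_left_if) simp
  qed
  ultimately show ?thesis using b_pos
    by (metis mult.commute mult_divide_mult_cancel_left less_irrefl)
qed

lemma G_eq: "G l \<mu> \<alpha> \<beta> = a + \<alpha> * \<beta> / a"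
  unfolding G_def sqrt_s1 by simp

lemma d1_eq: "d1 l \<mu> \<alpha> \<beta> c = (b - l * \<mu> * (a / b) / G l \<mu> \<alpha> \<beta>) / c"
  unfolding d1_def sqrt_s1 by simp

abbreviation \<gamma> :: real where "\<gamma> \<equiv> gamma1 l \<mu> \<alpha> \<beta>"

lemma gamma1_bounds: "0 < \<gamma>" "\<gamma> < 1"
  using pos b_gt by (simp_all add: gamma1_eq)

abbreviation \<gamma>' :: real where "\<gamma>' \<equiv> gamma2 l \<mu> \<alpha> \<beta>"

text \<open>That \<open>l / (l + \<beta>)\<close> separates the two decay rates is what makes both
  coefficients \<open>slow\<close> and \<open>fast\<close> positive.\<close>

lemma gamma2_bounds: "0 < \<gamma>'" "\<gamma>' < l / (l + \<beta>)" "l / (l + \<beta>) < \<gamma>"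
proof -
  show "0 < \<gamma>'" using b_pos pos by (simp add: gamma2_eq)
  have "\<gamma>' = l / (l + \<beta>) * (b / \<mu>)" by (simp add: gamma2_eq)
  also have "\<dots> < l / (l + \<beta>) * 1" using b_less pos by (intro mult_strict_left_mono) auto
  finally show "\<gamma>' < l / (l + \<beta>)" by simp
  show "l / (l + \<beta>) < \<gamma>"
    unfolding gamma1_eq using b_gt pos b_pos by (intro divide_strict_left_mono) auto
qed

text \<open>Together with \<open>gamma_prod\<close>, this identifies the coefficients of the
  recurrence for the Up probabilities.\<close>

lemma gamma_sum: "\<gamma> + \<gamma>' = l * (l + \<beta> + \<mu> + \<alpha>) / (\<mu> * (l + \<beta>))"
proof -
  have "l * s / (\<mu> * k) = l / b + l * b / (\<mu> * k)" if "k \<noteq> 0" "b * s = \<mu> * k + b * b" for k s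
  proof -
    have "l * s / (\<mu> * k) = l * (b * s) / (b * (\<mu> * k))"
      using b_pos by simp
    also have "\<dots> = l / b + l * b / (\<mu> * k)"
      unfolding that(2) using that(1) b_pos pos(2) by (simp add: field_simps)
    finally show ?thesis .
  qed
  from this[OF _ b_root] show ?thesis
    using pos by (simp add: gamma1_eq gamma2_eq)
qed

lemma gamma_prod: "\<gamma> * \<gamma>' = l * l / (\<mu> * (l + \<beta>))"
  using b_pos by (simp add: gamma1_eq gamma2_eq)

lemma harm_Down: "harm l \<mu> \<alpha> \<beta> (x, Down) = \<gamma> powi (- x) * (\<beta> / a)"
  by (simp add: sqrt_s1)

section \<open>Twisted chain: one-step expectations and escape probabilities\<close>

context
  fixes c :: real
  assumes c: "c \<ge> l + \<mu> + \<alpha> + \<beta>"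
begin

lemma c_pos: "c > 0" using c pos by simp

abbreviation K :: "int \<times> status \<Rightarrow> (int \<times> status) pmf" where "K \<equiv> twisted l \<mu> \<alpha> \<beta> c"
abbreviation Pos :: "(int \<times> status) set" where "Pos \<equiv> {z. fst z > 0}"
abbreviation v :: "int \<times> status \<Rightarrow> real" where "v z \<equiv> 1 / harm l \<mu> \<alpha> \<beta> z"

lemma set_twisted: "set_pmf (K (m, \<sigma>)) \<subseteq> {m - 1, m, m + 1} \<times> {Up, Down}"
proof
  fix w assume "w \<in> set_pmf (K (m, \<sigma>))"
  then have "free_kernel l \<mu> \<alpha> \<beta> c (m, \<sigma>) w \<noteq> 0"
    by (auto simp: set_pmf_iff pmf_twisted[OF pos c] twisted_kernel_def)
  then show "w \<in> {m - 1, m, m + 1} \<times> {Up, Down}"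
    by (cases "(l, \<mu>, \<alpha>, \<beta>, c, (m, \<sigma>), w)" rule: free_kernel.cases) (auto split: if_splits)
qed

lemma integrable_twisted: "integrable (measure_pmf (K z)) (F :: _ \<Rightarrow> real)"
  by (rule integrable_measure_pmf_finite, rule finite_subset[OF set_twisted[of "fst z" "snd z", simplified]])
     simp

lemma expectation_twisted_sum:
  "measure_pmf.expectation (K (m, \<sigma>)) F
    = (\<Sum>w\<in>{m - 1, m, m + 1} \<times> {Up, Down}. F w * twisted_kernel l \<mu> \<alpha> \<beta> c (m, \<sigma>) w)"
  using set_twisted
  by (subst integral_measure_pmf_real[where A = "{m - 1, m, m + 1} \<times> {Up, Down}"])
     (auto simp: pmf_twisted[OF pos c])

lemma gamma1_powi:
  "\<gamma> powi (- m - 1) = \<gamma> powi (- m) / \<gamma>" "\<gamma> powi (- 1 - m) = \<gamma> powi (- m) / \<gamma>"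
  "\<gamma> powi (1 - m) = \<gamma> powi (- m) * \<gamma>"
  using gamma1_bounds by (simp_all add: power_int_diff power_int_minus field_simps)

text \<open>The quotient of \<open>harm\<close> values multiplies the arrival rate by
  \<open>b / l\<close>, the service rate by \<open>l / b\<close> and the breakdown rate by
  \<open>\<beta> / a\<close>.\<close>

lemma expectation_twisted_Up:
  "measure_pmf.expectation (K (m, Up)) F
    = (b * F (m + 1, Up) + \<mu> * l / b * F (m - 1, Up) + \<alpha> * \<beta> / a * F (m, Down)
       + (c - (l + \<mu> + \<alpha>)) * F (m, Up)) / c"
proof -
  have "\<gamma> powi (- m) > 0" using gamma1_bounds by simp
  then show ?thesis
    unfolding expectation_twisted_sum using c_pos a_pos b_pos pos
    by (simp add: sum.cartesian_product[symmetric] twisted_kernel_def harm_Down gamma1_powi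
        gamma1_eq[symmetric] del: harm.simps(2))
       (simp add: gamma1_eq field_simps)
qed

lemma expectation_twisted_Down:
  "measure_pmf.expectation (K (m, Down)) F
    = (b * F (m + 1, Down) + a * F (m, Up) + (c - (l + \<beta>)) * F (m, Down)) / c"
proof -
  have "\<gamma> powi (- m) > 0" using gamma1_bounds by simp
  then show ?thesis
    unfolding expectation_twisted_sum using c_pos a_pos b_pos pos
    by (simp add: sum.cartesian_product[symmetric] twisted_kernel_def harm_Down gamma1_powi
        gamma1_eq[symmetric] del: harm.simps(2))
       (simp add: gamma1_eq field_simps)
qed

lemma inverse_harm: "v (m, Up) = \<gamma> powi m" "v (m, Down) = \<gamma> powi m * (a / \<beta>)"
  using a_pos pos by (simp_all add: harm_Down power_int_minus field_simps del: harm.simps(2))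

lemma inverse_harm_pos: "v z > 0"
  using harm_pos[OF pos] by simp

text \<open>The bound \<open>a < \<beta>\<close> absorbs the factor at Down states, so one geometric
  bound serves both statuses.\<close>

lemma inverse_harm_le:
  assumes "m \<ge> 0"
  shows "v (m, \<sigma>) \<le> \<gamma> ^ nat m"
proof -
  have "\<gamma> powi m = \<gamma> ^ nat m" using assms by (simp add: power_int_def)
  moreover have "\<gamma> ^ nat m * (a / \<beta>) \<le> \<gamma> ^ nat m * 1"
    using a_less pos gamma1_bounds by (intro mult_left_mono) auto
  ultimately show ?thesis
    by (cases \<sigma>) (simp_all add: inverse_harm del: harm.simps)
qed

text \<open>This reflects that the rows of \<open>free_kernel\<close> sum to 1: constants are
  harmonic for the free process, and the twist divides harmonic functions by
  \<open>harm\<close>.\<close>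

lemma expectation_inverse_harm: "measure_pmf.expectation (K z) v = v z"
proof -
  obtain m \<sigma> where z: "z = (m, \<sigma>)" by (cases z)
  have pw: "\<gamma> powi (m + 1) = \<gamma> powi m * (l / b)" "\<gamma> powi (m - 1) = \<gamma> powi m * (b / l)"
    using gamma1_bounds pos b_pos
    by (simp_all add: power_int_add power_int_diff gamma1_eq del: power_int_divide_distrib)
  show ?thesis
  proof (cases \<sigma>)
    case Up
    then show ?thesis
      unfolding z Up expectation_twisted_Up inverse_harm pw
      using c_pos a_pos b_pos pos by (simp add: field_simps)
  next
    case Down
    then show ?thesis
      unfolding z Down expectation_twisted_Down inverse_harm pw
      using c_pos a_pos b_pos pos by (simp add: field_simps)
  qed
qed

text \<open>Only a service can lead out of \<open>Pos\<close>, and it does so into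
  \<open>(0, Up)\<close>, where \<open>F\<close> vanishes; the indicator therefore changes
  nothing.\<close>

lemma expectation_twisted_Pos:
  fixes F :: "int \<times> status \<Rightarrow> real"
  assumes "z \<in> Pos" "F (0, Up) = 0"
  shows "measure_pmf.expectation (K z) (\<lambda>w. indicator Pos w * F w) = measure_pmf.expectation (K z) F"
proof -
  obtain m \<sigma> where z: "z = (m, \<sigma>)" by (cases z)
  have "indicator Pos (m - 1, Up) * F (m - 1, Up) = F (m - 1, Up)"
    using assms z by (cases "m = 1") (auto simp: indicator_def)
  then show ?thesis
    using assms unfolding z
    by (cases \<sigma>) (simp_all add: expectation_twisted_Up expectation_twisted_Down)
qed

lemma expectation_one_minus:
  "measure_pmf.expectation (K z) (\<lambda>w. 1 - v w) = 1 - v z"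
  using expectation_inverse_harm[of z] by (simp add: integrable_twisted)

text \<open>By decay a positive \<open>g\<close> attains its maximum. Starting from level 0, where \<open>g\<close> vanishes, a maximum is
  excluded level by level: every Up state has a positive rate to the level below and every Down state
  to the Up state of its level.\<close>

lemma killed_harmonic_zero:
  assumes nonneg: "\<And>z. g z \<ge> 0"
    and harmonic: "\<And>z. z \<in> Pos \<Longrightarrow> g z = measure_pmf.expectation (K z) g"
    and zero: "\<And>z. z \<notin> Pos \<Longrightarrow> g z = 0"
    and decay: "\<And>z. z \<in> Pos \<Longrightarrow> g z \<le> v z"
  shows "g z0 = 0"
proof (rule ccontr)
  assume "g z0 \<noteq> 0"
  then have z0: "g z0 > 0" "z0 \<in> Pos" using nonneg[of z0] zero[of z0] by auto
  \<comment> \<open>From level \<open>N\<close> on, the decay bound keeps \<open>g\<close> below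
    \<open>g z0\<close>; hence \<open>S\<close> is finite and a maximum exists.\<close>
  obtain N where N: "\<gamma> ^ N < g z0"
    using real_arch_pow_inv[OF z0(1) gamma1_bounds(2)] by blast
  define S where "S = {z \<in> Pos. g z \<ge> g z0}"
  have "S \<subseteq> {1..int N} \<times> {Up, Down}"
  proof
    fix z assume z: "z \<in> S"
    obtain m \<sigma> where m: "z = (m, \<sigma>)" by (cases z)
    have "m > 0" using z m by (simp add: S_def)
    have "g z0 \<le> \<gamma> ^ nat m"
      using z decay[of z] inverse_harm_le[of m \<sigma>] m by (auto simp: S_def)
    then have "\<gamma> ^ N < \<gamma> ^ nat m" using N by simp
    then have "nat m < N"
      using gamma1_bounds power_decreasing[of N "nat m" \<gamma>] by (cases "N \<le> nat m") auto
    then show "z \<in> {1..int N} \<times> {Up, Down}"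
      using \<open>m > 0\<close> m by (cases \<sigma>) auto
  qed
  then have "finite S" by (rule finite_subset) auto
  moreover have "z0 \<in> S" using z0 by (simp add: S_def)
  ultimately obtain z1 where z1: "z1 \<in> S" "\<And>z. z \<in> S \<Longrightarrow> g z \<le> g z1"
    using Max_in[of "g ` S"] Max_ge[of "g ` S"] by (metis empty_iff finite_imageI image_iff)
  define M where "M = g z1"
  have M_pos: "M > 0" using z1(1) z0(1) by (simp add: S_def M_def)
  have le_M: "g z \<le> M" for z
  proof (cases "z \<in> S")
    case True
    then show ?thesis using z1(2) by (simp add: M_def)
  next
    case False
    then show ?thesis
      using zero[of z] M_pos z1(1) by (cases "z \<in> Pos") (auto simp: S_def M_def)
  qed
  \<comment> \<open>The expectation of the constant 1 is 1, so twisting preserves the total jump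
    rate out of an Up state.\<close>
  have rates: "b + \<mu> * l / b + \<alpha> * \<beta> / a = l + \<mu> + \<alpha>"
    using expectation_twisted_Up[of 0 "\<lambda>_. 1"] c_pos by (simp add: field_simps)
  have Up_less: "g (m + 1, Up) < M" if "m \<ge> 0" "g (m, Up) < M" for m
  proof -
    have "g (m + 1, Up) * c = b * g (m + 1 + 1, Up) + \<mu> * l / b * g (m, Up) + \<alpha> * \<beta> / a * g (m + 1, Down)
       + (c - (l + \<mu> + \<alpha>)) * g (m + 1, Up)"
      using harmonic[of "(m + 1, Up)"] that c_pos by (simp add: expectation_twisted_Up eq_divide_eq)
    moreover have "b * g (m + 1 + 1, Up) \<le> b * M" "\<alpha> * \<beta> / a * g (m + 1, Down) \<le> \<alpha> * \<beta> / a * M"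
      using le_M a_pos b_pos pos by (intro mult_left_mono; simp)+
    moreover have "\<mu> * l / b * g (m, Up) < \<mu> * l / b * M"
      using that b_pos pos by (intro mult_strict_left_mono) auto
    \<comment> \<open>The terms with factor \<open>c\<close> cancel, which leaves a comparison of
      jump rates.\<close>
    ultimately have "(l + \<mu> + \<alpha>) * g (m + 1, Up) < (b + \<mu> * l / b + \<alpha> * \<beta> / a) * M"
      by (simp only: distrib_right left_diff_distrib mult.commute[of _ c])
    then show ?thesis unfolding rates using pos by simp
  qed
  have Up: "g (int n, Up) < M" for n
  proof (induction n)
    case 0
    then show ?case using zero M_pos by simp
  next
    case (Suc n)
    then show ?case using Up_less[of "int n"] by (simp add: add.commute)
  qed
  have Down: "g (m, Down) < M" if "m > 0" for m
  proof -
    have "g (m, Down) * c = b * g (m + 1, Down) + a * g (m, Up) + (c - (l + \<beta>)) * g (m, Down)"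
      using harmonic[of "(m, Down)"] that c_pos by (simp add: expectation_twisted_Down eq_divide_eq)
    moreover have "b * g (m + 1, Down) \<le> b * M"
      using le_M b_pos by (intro mult_left_mono) auto
    moreover have "a * g (m, Up) < a * M"
      using Up[of "nat m"] that a_pos by simp
    ultimately have "(l + \<beta>) * g (m, Down) < (b + a) * M"
      by (simp only: distrib_right left_diff_distrib mult.commute[of _ c])
    then show ?thesis using pos by (simp add: b_def)
  qed
  obtain m \<sigma> where "z1 = (m, \<sigma>)" by (cases z1)
  then show False
    using z1 Up[of "nat m"] Down[of m] by (cases \<sigma>) (auto simp: S_def M_def)
qed

text \<open>The function \<open>1 - v\<close> is harmonic and vanishes at \<open>(0, Up)\<close>,
  hence is a lower bound by \<open>stay_forever_ge\<close>. The excess over it is at most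
  \<open>v\<close>, because probabilities are at most 1, so \<open>killed_harmonic_zero\<close>
  forces it to be 0.\<close>

lemma stay_forever_twisted:
  assumes z: "z \<in> Pos"
  shows "stay_forever K Pos z = 1 - v z"
proof -
  have v_le: "v w \<le> 1" if "w \<in> Pos" for w
  proof -
    have "v w \<le> \<gamma> ^ nat (fst w)"
      using inverse_harm_le[of "fst w" "snd w"] that by simp
    also have "\<dots> \<le> 1" using gamma1_bounds by (intro power_le_one) auto
    finally show ?thesis .
  qed
  have v0: "1 - v (0, Up) = 0" by simp
  have ge: "1 - v w \<le> stay_forever K Pos w" if "w \<in> Pos" for w
    by (rule stay_forever_ge)
       (use that v_le inverse_harm_pos[THEN less_imp_le] in
        \<open>auto simp: expectation_twisted_Pos[where F = "\<lambda>w. 1 - v w", OF _ v0] expectation_one_minus simp del: harm.simps\<close>)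
  define g where "g w = indicator Pos w * (stay_forever K Pos w - (1 - v w))" for w
  have "g z = 0"
  proof (rule killed_harmonic_zero)
    show "g w \<ge> 0" for w using ge[of w] by (simp add: g_def indicator_def)
    show "g w = measure_pmf.expectation (K w) g" if "w \<in> Pos" for w
    proof -
      have "measure_pmf.expectation (K w) g
        = measure_pmf.expectation (K w) (\<lambda>w. indicator Pos w * stay_forever K Pos w)
          - measure_pmf.expectation (K w) (\<lambda>w. indicator Pos w * (1 - v w))"
        unfolding g_def right_diff_distrib[of "indicator Pos _" "stay_forever _ _ _"]
        by (rule Bochner_Integration.integral_diff) (rule integrable_twisted)+
      also have "\<dots> = g w"
        using that expectation_twisted_Pos[where F = "\<lambda>w. 1 - v w", OF that v0] expectation_one_minus[of w]
        by (simp add: stay_forever_step[symmetric] g_def)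
      finally show ?thesis by simp
    qed
    show "g w = 0" if "w \<notin> Pos" for w using that by (simp add: g_def)
    show "g w \<le> v w" if "w \<in> Pos" for w
      using that stay_forever_bounds[of K Pos w] by (simp add: g_def)
  qed
  then show ?thesis using z by (simp add: g_def)
qed

text \<open>From level 0 only an arrival, of probability \<open>b / c\<close>, enters
  \<open>Pos\<close>; it keeps the status, and \<open>1 - v\<close> at level 1 is the other
  factor.\<close>

lemma escape_Up: "escape l \<mu> \<alpha> \<beta> c (0, Up) = b / c * (1 - \<gamma>)"
  and escape_Down: "escape l \<mu> \<alpha> \<beta> c (0, Down) = b / c * (1 - \<gamma> * (a / \<beta>))"
proof -
  have esc: "escape l \<mu> \<alpha> \<beta> c z = stay_forever K Pos z" for z
    by (simp add: escape_def stay_forever_def)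
  show "escape l \<mu> \<alpha> \<beta> c (0, Up) = b / c * (1 - \<gamma>)"
    unfolding esc
    by (subst stay_forever_step)
       (simp add: expectation_twisted_Up stay_forever_twisted inverse_harm del: harm.simps)
  show "escape l \<mu> \<alpha> \<beta> c (0, Down) = b / c * (1 - \<gamma> * (a / \<beta>))"
    unfolding esc
    by (subst stay_forever_step)
       (simp add: expectation_twisted_Down stay_forever_twisted inverse_harm del: harm.simps)
qed

text \<open>Only the values of \<open>p\<close> at level 0 enter, and \<open>c\<close> cancels
  between \<open>eta1\<close> and \<open>d1\<close>.\<close>

lemma C1_Up_eq:
  assumes p: "pmf p (0, Down) = \<alpha> / (l + \<beta>) * pmf p (0, Up)"
  shows "C1_Up l \<mu> \<alpha> \<beta> c p = pmf p (0, Up) * (\<gamma> - l / (l + \<beta>)) / (\<gamma> - gamma2 l \<mu> \<alpha> \<beta>)"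
proof -
  have "eta1 l \<mu> \<alpha> \<beta> c p = pmf p (0, Up) * (b / c * (1 - l / b))
      + \<alpha> / (l + \<beta>) * pmf p (0, Up) * (\<beta> / a) * (b / c * (1 - l / b * (a / \<beta>)))"
    by (simp add: eta1_def escape_Up escape_Down sqrt_s1 p gamma1_eq)
  then show ?thesis
    using C1_identity[OF a_pos pos(1) b_gt(1) b_less c_pos alpha_eq beta_eq, of "pmf p (0, Up)"]
    by (simp add: C1_Up_def sqrt_s1 d1_eq G_eq gamma1_eq gamma2_eq)
qed

end

section \<open>Balance equations and the exact form of the Up probabilities\<close>

lemma sum_infinite_rate_Up:
  "(\<Sum>\<^sub>\<infinity>v\<in>-{(x, Up)}. unreliable_rate l \<mu> \<alpha> \<beta> (x, Up) v) = l + \<alpha> + (if x > 0 then \<mu> else 0)"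
proof (rule infsumI, rule has_sum_finite_neutralI)
  let ?B = "{(x + 1, Up), (x, Down)} \<union> (if x > 0 then {(x - 1, Up)} else {})"
  show "finite ?B" "?B \<subseteq> -{(x, Up)}" by (auto split: if_splits)
  show "l + \<alpha> + (if x > 0 then \<mu> else 0) = (\<Sum>v\<in>?B. unreliable_rate l \<mu> \<alpha> \<beta> (x, Up) v)"
    by auto
  show "unreliable_rate l \<mu> \<alpha> \<beta> (x, Up) v = 0" if "v \<in> -{(x, Up)} - ?B" for v
    using that by (cases v; cases "snd v") (auto split: if_splits)
qed

lemma sum_infinite_rate_Down:
  "(\<Sum>\<^sub>\<infinity>v\<in>-{(x, Down)}. unreliable_rate l \<mu> \<alpha> \<beta> (x, Down) v) = l + \<beta>"
proof (rule infsumI, rule has_sum_finite_neutralI)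
  let ?B = "{(x + 1, Down), (x, Up)}"
  show "finite ?B" "?B \<subseteq> -{(x, Down)}" by auto
  show "l + \<beta> = (\<Sum>v\<in>?B. unreliable_rate l \<mu> \<alpha> \<beta> (x, Down) v)"
    by auto
  show "unreliable_rate l \<mu> \<alpha> \<beta> (x, Down) v = 0" if "v \<in> -{(x, Down)} - ?B" for v
    using that by (cases v; cases "snd v") auto
qed

context
  fixes p :: "(nat \<times> status) pmf"
  assumes stat: "stationary (unreliable_rate l \<mu> \<alpha> \<beta>) p"
begin

abbreviation u :: "nat \<Rightarrow> real" where "u k \<equiv> pmf p (k, Up)"
abbreviation d :: "nat \<Rightarrow> real" where "d k \<equiv> pmf p (k, Down)"

lemma balance_Down: "(l + \<beta>) * d k = \<alpha> * u k + (if k > 0 then l * d (k - 1) else 0)"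
proof (cases k)
  case 0
  let ?B = "{(k, Up), (k, Down)}"
  have "generator (unreliable_rate l \<mu> \<alpha> \<beta>) z (k, Down) = 0" if "z \<notin> ?B" for z
    using that 0 by (cases z; cases "snd z") (auto simp: generator_def)
  then have "(\<Sum>z\<in>?B. pmf p z * generator (unreliable_rate l \<mu> \<alpha> \<beta>) z (k, Down)) = 0"
    by (intro stationary_sum_eq_0[OF stat]) auto
  then show ?thesis
    using 0 by (simp add: generator_def sum_infinite_rate_Down algebra_simps)
next
  case (Suc j)
  let ?B = "{(k, Up), (k, Down), (j, Down)}"
  have "generator (unreliable_rate l \<mu> \<alpha> \<beta>) z (k, Down) = 0" if "z \<notin> ?B" for z
    using that Suc by (cases z; cases "snd z") (auto simp: generator_def)
  then have "(\<Sum>z\<in>?B. pmf p z * generator (unreliable_rate l \<mu> \<alpha> \<beta>) z (k, Down)) = 0"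
    by (intro stationary_sum_eq_0[OF stat]) auto
  then show ?thesis
    using Suc by (simp add: generator_def sum_infinite_rate_Down algebra_simps)
qed

lemma balance_Up:
  "(l + \<alpha> + (if k > 0 then \<mu> else 0)) * u k
    = \<mu> * u (k + 1) + \<beta> * d k + (if k > 0 then l * u (k - 1) else 0)"
proof (cases k)
  case 0
  let ?B = "{(k, Up), (k, Down), (k + 1, Up)}"
  have "generator (unreliable_rate l \<mu> \<alpha> \<beta>) z (k, Up) = 0" if "z \<notin> ?B" for z
    using that 0 by (cases z; cases "snd z") (auto simp: generator_def)
  then have "(\<Sum>z\<in>?B. pmf p z * generator (unreliable_rate l \<mu> \<alpha> \<beta>) z (k, Up)) = 0"
    by (intro stationary_sum_eq_0[OF stat]) auto
  then show ?thesis
    using 0 by (simp add: generator_def sum_infinite_rate_Up algebra_simps)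
next
  case (Suc j)
  let ?B = "{(k, Up), (k, Down), (k + 1, Up), (j, Up)}"
  have "generator (unreliable_rate l \<mu> \<alpha> \<beta>) z (k, Up) = 0" if "z \<notin> ?B" for z
    using that Suc by (cases z; cases "snd z") (auto simp: generator_def)
  then have "(\<Sum>z\<in>?B. pmf p z * generator (unreliable_rate l \<mu> \<alpha> \<beta>) z (k, Up)) = 0"
    by (intro stationary_sum_eq_0[OF stat]) auto
  then show ?thesis
    using Suc by (simp add: generator_def sum_infinite_rate_Up algebra_simps)
qed

text \<open>Adding the Up and Down balance equations at one level carries the equality of flows
  across a cut from each level to the next.\<close>

lemma cut: "\<mu> * u (k + 1) = l * (u k + d k)"
proof (induction k)
  case 0
  then show ?case using balance_Up[of 0] balance_Down[of 0] by (simp add: algebra_simps)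
next
  case (Suc k)
  then show ?case using balance_Up[of "Suc k"] balance_Down[of "Suc k"] by (simp add: algebra_simps)
qed

text \<open>Summing the Down balance over all levels yields
  \<open>\<beta> * D = \<alpha> * U\<close>, which with \<open>U + D = 1\<close> determines
  \<open>U\<close>; summing the cut equation yields \<open>\<mu> * (U - u 0) = l\<close>.\<close>

lemma u_0: "u 0 = \<beta> / (\<alpha> + \<beta>) - l / \<mu>"
proof -
  define U where "U = measure_pmf.prob p {z. snd z = Up}"
  define D where "D = measure_pmf.prob p {z. snd z = Down}"
  have sums: "(\<lambda>k. pmf p (k, \<sigma>)) sums measure_pmf.prob p {z. snd z = \<sigma>}" for \<sigma>
  proof -
    have "(\<lambda>k. measure_pmf.prob p {(k, \<sigma>)}) sums measure_pmf.prob p (\<Union>k. {(k, \<sigma>)})"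
      by (rule measure_pmf.finite_measure_UNION) (auto simp: disjoint_family_on_def)
    moreover have "(\<Union>k. {(k, \<sigma>)}) = {z :: nat \<times> status. snd z = \<sigma>}" by auto
    ultimately show ?thesis by (simp add: measure_pmf_single)
  qed
  have U: "u sums U" and D: "d sums D" using sums by (simp_all add: U_def D_def)
  have tail: "(\<lambda>k. u (Suc k)) sums (U - u 0)" "(\<lambda>k. d (Suc k)) sums (D - d 0)"
    using U D sums_Suc_iff[of u "U - u 0"] sums_Suc_iff[of d "D - d 0"] by simp_all
  have "{z. snd z = Up} \<union> {z. snd z = Down} = (UNIV :: (nat \<times> status) set)"
    using status.exhaust by blast
  moreover have "{z. snd z = Up} \<inter> {z. snd z = Down} = ({} :: (nat \<times> status) set)"
    by auto
  ultimately have total: "U + D = 1"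
    using measure_pmf.finite_measure_Union[of "{z. snd z = Up}" p "{z. snd z = Down}"]
    by (auto simp: U_def D_def)
  have "(\<lambda>k. (l + \<beta>) * d (Suc k)) sums ((l + \<beta>) * (D - d 0))"
    using tail by (intro sums_mult)
  moreover have "(\<lambda>k. (l + \<beta>) * d (Suc k)) sums (\<alpha> * (U - u 0) + l * D)"
  proof -
    have "(\<lambda>k. \<alpha> * u (Suc k) + l * d k) sums (\<alpha> * (U - u 0) + l * D)"
      using tail D by (intro sums_add sums_mult)
    then show ?thesis by (simp add: balance_Down)
  qed
  ultimately have "(l + \<beta>) * (D - d 0) = \<alpha> * (U - u 0) + l * D" by (rule sums_unique2)
  then have "\<beta> * D = \<alpha> * U" using balance_Down[of 0] by (simp add: algebra_simps)
  with total have U_eq: "(\<alpha> + \<beta>) * U = \<beta>" by algebra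
  have "(\<lambda>k. \<mu> * u (k + 1)) sums (\<mu> * (U - u 0))"
    using sums_mult[OF tail(1), of \<mu>] by simp
  moreover have "(\<lambda>k. \<mu> * u (k + 1)) sums (l * (U + D))"
    unfolding cut using U D by (intro sums_add sums_mult)
  ultimately have "\<mu> * (U - u 0) = l * (U + D)" by (rule sums_unique2)
  then have "\<mu> * (U - u 0) = l" by (simp add: total)
  then have "u 0 = U - l / \<mu>" using pos(2) by (simp add: field_simps)
  moreover have "U = \<beta> / (\<alpha> + \<beta>)" using U_eq pos by (simp add: field_simps)
  ultimately show ?thesis by simp
qed

lemma u_0_pos: "u 0 > 0"
proof -
  have "u 0 = (\<beta> * \<mu> - l * (\<alpha> + \<beta>)) / ((\<alpha> + \<beta>) * \<mu>)"
    unfolding u_0 using pos by (subst diff_frac_eq) auto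
  then show ?thesis using stable' pos by simp
qed

lemma d_0: "d 0 = \<alpha> / (l + \<beta>) * u 0"
  using balance_Down[of 0] pos by (simp add: field_simps)

text \<open>Two consecutive cut equations express \<open>d k\<close> and \<open>d (k + 1)\<close>
  through \<open>u\<close>; inserting them into the Down balance at level \<open>k + 1\<close>
  eliminates \<open>d\<close>.\<close>

lemma u_recurrence: "u (k + 2) = (\<gamma> + \<gamma>') * u (k + 1) - \<gamma> * \<gamma>' * u k"
proof -
  have "(l + \<beta>) * (\<mu> * u (k + 2)) = l * (l + \<beta> + \<mu> + \<alpha>) * u (k + 1) - l * l * u k"
    using cut[of k] cut[of "Suc k"] balance_Down[of "Suc k"] by (simp add: numeral_2_eq_2) algebra
  then have "u (k + 2) = (l * (l + \<beta> + \<mu> + \<alpha>) * u (k + 1) - l * l * u k) / (\<mu> * (l + \<beta>))"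
    using pos by (simp add: eq_divide_eq mult_ac)
  then show ?thesis
    unfolding gamma_sum gamma_prod by (simp add: diff_divide_distrib)
qed

text \<open>The pair \<open>slow\<close>, \<open>fast\<close> solves the initial conditions
  \<open>slow + fast = u 0\<close> and \<open>slow * \<gamma> + fast * \<gamma>' = u 1\<close>,
  where \<open>u 1 = (\<gamma> + \<gamma>' - l / (l + \<beta>)) * u 0\<close>.\<close>

definition slow :: real where "slow = u 0 * (\<gamma> - l / (l + \<beta>)) / (\<gamma> - \<gamma>')"
definition fast :: real where "fast = u 0 * (l / (l + \<beta>) - \<gamma>') / (\<gamma> - \<gamma>')"

lemma slow_fast_pos: "slow > 0" "fast > 0"
  using gamma2_bounds u_0_pos by (simp_all add: slow_def fast_def)

lemma u_eq: "u k = slow * \<gamma> ^ k + fast * \<gamma>' ^ k"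
proof (induction k rule: induct_nat_012)
  case 0
  have "\<gamma> - \<gamma>' \<noteq> 0" using gamma2_bounds by simp
  then show ?case
    by (simp add: slow_def fast_def add_divide_distrib[symmetric] distrib_left[symmetric])
next
  case 1
  have ne: "\<gamma> - \<gamma>' \<noteq> 0" using gamma2_bounds by simp
  have "u 1 = l / \<mu> * (1 + \<alpha> / (l + \<beta>)) * u 0"
    using cut[of 0] pos(2) by (simp add: d_0 field_simps)
  also have "l / \<mu> * (1 + \<alpha> / (l + \<beta>)) = \<gamma> + \<gamma>' - l / (l + \<beta>)"
  proof -
    have "l / \<mu> * (1 + \<alpha> / k) = l * (k + \<mu> + \<alpha>) / (\<mu> * k) - l / k" if "k \<noteq> 0" for k
      using that pos by (simp add: field_simps)
    from this[of "l + \<beta>"] show ?thesis unfolding gamma_sum using pos by simp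
  qed
  also have "(\<gamma> + \<gamma>' - x) * u 0 = u 0 * (\<gamma> - x) / (\<gamma> - \<gamma>') * \<gamma> + u 0 * (x - \<gamma>') / (\<gamma> - \<gamma>') * \<gamma>'" for x
  proof -
    have "(\<gamma> + \<gamma>' - x) * u 0 * (\<gamma> - \<gamma>') = u 0 * (\<gamma> - x) * \<gamma> + u 0 * (x - \<gamma>') * \<gamma>'"
      by algebra
    then show ?thesis using ne by (simp add: eq_divide_eq add_divide_distrib[symmetric])
  qed
  finally show ?case by (simp add: slow_def fast_def)
next
  case (ge2 k)
  then show ?case using u_recurrence[of k] by (simp add: algebra_simps)
qed

lemma C1_Up_eq_slow:
  assumes "c \<ge> l + \<mu> + \<alpha> + \<beta>"
  shows "C1_Up l \<mu> \<alpha> \<beta> c p = slow"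
  using C1_Up_eq[OF assms d_0] by (simp add: slow_def)

text \<open>The factor \<open>u 0\<close> cancels in \<open>slow / fast\<close>, so the quotient
  depends on \<alpha> only through the two decay rates, whose limits are elementary.\<close>

lemma u_over_fast:
  "u k / (fast * \<gamma>' ^ k) = 1 + (\<gamma> - l / (l + \<beta>)) / (l / (l + \<beta>) - \<gamma>') * (\<gamma> / \<gamma>') ^ k"
proof -
  have "u k / (fast * \<gamma>' ^ k) = 1 + slow / fast * (\<gamma> / \<gamma>') ^ k"
    using slow_fast_pos gamma2_bounds by (simp add: u_eq add_divide_distrib power_divide)
  also have "slow / fast = (\<gamma> - l / (l + \<beta>)) / (l / (l + \<beta>) - \<gamma>')"
    using u_0_pos gamma2_bounds by (simp add: slow_def fast_def)
  finally show ?thesis .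
qed

end

end

section \<open>The limit as \<alpha> tends to 0, and the conclusion\<close>

lemma gamma_limits:
  assumes "l > 0" "\<mu> > 0" "\<beta> > 0" "\<mu> > l + \<beta>"
  shows "((\<lambda>\<alpha>. gamma1 l \<mu> \<alpha> \<beta>) \<longlongrightarrow> l / (l + \<beta>)) (at_right 0)"
    and "((\<lambda>\<alpha>. gamma2 l \<mu> \<alpha> \<beta>) \<longlongrightarrow> l / \<mu>) (at_right 0)"
proof -
  have "((\<lambda>\<alpha>. sqrt (s1 l \<mu> \<alpha> \<beta>)) \<longlongrightarrow> sqrt ((\<mu> - l - \<beta> - 0)\<^sup>2 + 4 * 0 * \<mu>)) (at_right 0)"
    unfolding s1_def by (intro tendsto_intros)
  \<comment> \<open>At \<alpha> = 0 the radicand is a square, and \<open>\<mu> > l + \<beta>\<close>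
    decides the sign of its root.\<close>
  then have sq: "((\<lambda>\<alpha>. sqrt (s1 l \<mu> \<alpha> \<beta>)) \<longlongrightarrow> \<mu> - l - \<beta>) (at_right 0)"
    using assms by simp
  have "((\<lambda>\<alpha>. gamma1 l \<mu> \<alpha> \<beta>) \<longlongrightarrow> 2 * l / (l + \<beta> + \<mu> + 0 - (\<mu> - l - \<beta>))) (at_right 0)"
    unfolding gamma1_def using assms by (intro tendsto_intros sq) auto
  moreover have "2 * l / (l + \<beta> + \<mu> + 0 - (\<mu> - l - \<beta>)) = l / (l + \<beta>)"
    using assms by (simp add: frac_eq_eq)
  ultimately show "((\<lambda>\<alpha>. gamma1 l \<mu> \<alpha> \<beta>) \<longlongrightarrow> l / (l + \<beta>)) (at_right 0)" by simp
  have "((\<lambda>\<alpha>. gamma2 l \<mu> \<alpha> \<beta>) \<longlongrightarrow> 2 * l / (l + \<beta> + \<mu> + 0 + (\<mu> - l - \<beta>))) (at_right 0)"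
    unfolding gamma2_def using assms by (intro tendsto_intros sq) auto
  then show "((\<lambda>\<alpha>. gamma2 l \<mu> \<alpha> \<beta>) \<longlongrightarrow> l / \<mu>) (at_right 0)" by simp
qed

text \<open>\<open>C_Up\<close> depends on \<alpha> and is fixed before \<open>c\<close> and
  \<open>k\<close>. The inner limit is 1 for every \<open>k\<close>, so \<open>L\<close> can be
  taken constant.\<close>

theorem proposition2p3:
  fixes l \<mu> \<beta> :: real and \<pi> :: "real \<Rightarrow> (nat \<times> status) pmf"
  assumes "l > 0" "\<mu> > 0" "\<beta> > 0" "\<mu> > l + \<beta>"
    and "\<And>\<alpha>. \<alpha> > 0 \<Longrightarrow> l < \<beta> / (\<alpha> + \<beta>) * \<mu> \<Longrightarrow> stationary (unreliable_rate l \<mu> \<alpha> \<beta>) (\<pi> \<alpha>)"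
  shows "\<exists>C_Up :: real \<Rightarrow> real.
    (\<forall>\<alpha>. \<alpha> > 0 \<and> l < \<beta> / (\<alpha> + \<beta>) * \<mu> \<longrightarrow>
      C_Up \<alpha> > 0 \<and>
      (\<forall>c \<ge> l + \<mu> + \<alpha> + \<beta>.
        (\<lambda>k. pmf (\<pi> \<alpha>) (k, Up) /
          (C1_Up l \<mu> \<alpha> \<beta> c (\<pi> \<alpha>) * gamma1 l \<mu> \<alpha> \<beta> ^ k + C_Up \<alpha> * gamma2 l \<mu> \<alpha> \<beta> ^ k))
        \<longlonglongrightarrow> 1)) \<and>
    (\<exists>L :: nat \<Rightarrow> real.
      (\<forall>k. ((\<lambda>\<alpha>. pmf (\<pi> \<alpha>) (k, Up) / (C_Up \<alpha> * gamma2 l \<mu> \<alpha> \<beta> ^ k)) \<longlongrightarrow> L k) (at_right 0)) \<and>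
      L \<longlonglongrightarrow> 1)"
proof -
  define C where "C \<alpha> = unreliable_queue.fast l \<mu> \<alpha> \<beta> (\<pi> \<alpha>)" for \<alpha>
  have queue: "unreliable_queue l \<mu> \<alpha> \<beta>" if "\<alpha> > 0" "l < \<beta> / (\<alpha> + \<beta>) * \<mu>" for \<alpha>
    using assms(1-3) that by unfold_locales
  have fixed: "C \<alpha> > 0 \<and>
      (\<forall>c \<ge> l + \<mu> + \<alpha> + \<beta>.
        (\<lambda>k. pmf (\<pi> \<alpha>) (k, Up) /
          (C1_Up l \<mu> \<alpha> \<beta> c (\<pi> \<alpha>) * gamma1 l \<mu> \<alpha> \<beta> ^ k + C \<alpha> * gamma2 l \<mu> \<alpha> \<beta> ^ k))
        \<longlonglongrightarrow> 1)"
    if \<alpha>: "\<alpha> > 0" "l < \<beta> / (\<alpha> + \<beta>) * \<mu>" for \<alpha>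
  proof (intro conjI allI impI)
    interpret unreliable_queue l \<mu> \<alpha> \<beta> by (rule queue[OF \<alpha>])
    note stat = assms(5)[OF \<alpha>]
    show "C \<alpha> > 0" using slow_fast_pos(2)[OF stat] by (simp add: C_def)
    fix c assume c: "c \<ge> l + \<mu> + \<alpha> + \<beta>"
    \<comment> \<open>The quotient is identically 1 by \<open>u_eq\<close>, once its denominator is
      known to be nonzero.\<close>
    have "slow (\<pi> \<alpha>) * gamma1 l \<mu> \<alpha> \<beta> ^ k + fast (\<pi> \<alpha>) * gamma2 l \<mu> \<alpha> \<beta> ^ k > 0" for k
      using slow_fast_pos[OF stat] gamma1_bounds gamma2_bounds(1) by (simp add: add_pos_pos)
    then show "(\<lambda>k. pmf (\<pi> \<alpha>) (k, Up) /
          (C1_Up l \<mu> \<alpha> \<beta> c (\<pi> \<alpha>) * gamma1 l \<mu> \<alpha> \<beta> ^ k + C \<alpha> * gamma2 l \<mu> \<alpha> \<beta> ^ k)) \<longlonglongrightarrow> 1"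
      by (simp add: C_def C1_Up_eq_slow[OF stat c] u_eq[OF stat] less_imp_neq[symmetric])
  qed
  have limit: "((\<lambda>\<alpha>. pmf (\<pi> \<alpha>) (k, Up) / (C \<alpha> * gamma2 l \<mu> \<alpha> \<beta> ^ k)) \<longlongrightarrow> 1) (at_right 0)" for k
  proof (rule Lim_transform_eventually)
    let ?x = "l / (l + \<beta>)"
    \<comment> \<open>The limit of the denominator \<open>?x - gamma2\<close> is nonzero because
      \<open>\<mu> > l + \<beta>\<close>.\<close>
    have "?x - l / \<mu> > 0" using assms(1-4) by (simp add: divide_strict_left_mono)
    then have "((\<lambda>\<alpha>. 1 + (gamma1 l \<mu> \<alpha> \<beta> - ?x) / (?x - gamma2 l \<mu> \<alpha> \<beta>)
        * (gamma1 l \<mu> \<alpha> \<beta> / gamma2 l \<mu> \<alpha> \<beta>) ^ k)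
      \<longlongrightarrow> 1 + (?x - ?x) / (?x - l / \<mu>) * (?x / (l / \<mu>)) ^ k) (at_right 0)"
      using assms(1,2) by (intro tendsto_intros gamma_limits assms(1-4)) auto
    then show "((\<lambda>\<alpha>. 1 + (gamma1 l \<mu> \<alpha> \<beta> - ?x) / (?x - gamma2 l \<mu> \<alpha> \<beta>)
        * (gamma1 l \<mu> \<alpha> \<beta> / gamma2 l \<mu> \<alpha> \<beta>) ^ k) \<longlongrightarrow> 1) (at_right 0)"
      by simp
    \<comment> \<open>For positive \<alpha>, stability means that \<alpha> lies below this bound, so
      the exact formula is available for all small \<alpha>.\<close>
    have "\<beta> * (\<mu> - l) / l > 0" using assms(1-4) by simp
    then have "\<forall>\<^sub>F \<alpha> in at_right 0. \<alpha> \<in> {0<..<\<beta> * (\<mu> - l) / l}"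
      by (rule eventually_at_right_real)
    then show "\<forall>\<^sub>F \<alpha> in at_right 0. 1 + (gamma1 l \<mu> \<alpha> \<beta> - ?x) / (?x - gamma2 l \<mu> \<alpha> \<beta>)
        * (gamma1 l \<mu> \<alpha> \<beta> / gamma2 l \<mu> \<alpha> \<beta>) ^ k
      = pmf (\<pi> \<alpha>) (k, Up) / (C \<alpha> * gamma2 l \<mu> \<alpha> \<beta> ^ k)"
    proof eventually_elim
      case (elim \<alpha>)
      then have \<alpha>: "\<alpha> > 0" "l < \<beta> / (\<alpha> + \<beta>) * \<mu>"
        using assms(1-3) by (simp_all add: field_simps)
      interpret unreliable_queue l \<mu> \<alpha> \<beta> by (rule queue[OF \<alpha>])
      show ?case using u_over_fast[OF assms(5)[OF \<alpha>], of k] by (simp add: C_def)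
    qed
  qed
  show ?thesis
    by (rule exI[of _ C], intro conjI exI[of _ "\<lambda>_. 1"]) (use fixed limit in auto)
qed

end
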